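(* Let $m,d\geq 1$. (1) If $x^m-1$ divides $M_d(x)$, then $x^m-1$ divides $M_{de}(x)$ for all integers $e\geq 1$. (2) If $x^m+1$ divides $M_d(x)$, then $x^m+1$ divides $M_{de}(x)$ for all odd integers $e\geq 1$.
   Context: $M_d(x)=\frac1d\sum_{e\mid d}\mu(e)x^{d/e}\in\mathbb{Q}[x]$ is the $d$th necklace polynomial, $\mu$ the Möbius function. *)

theory Defs
  imports
    "HOL-Computational_Algebra.Polynomial"
    "HOL-Computational_Algebra.Primes"
    "HOL-Computational_Algebra.Squarefree"
begin

definition moebius_mu :: "nat \<Rightarrow> int" where
  "moebius_mu n = (if squarefree n then (- 1) ^ card (prime_factors n) else 0)"

(* Only meaningful for d >= 1. *)
definition necklace_poly :: "nat \<Rightarrow> rat poly" where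
  "necklace_poly d =
     smult (1 / of_nat d)
       (\<Sum>e | e dvd d. monom (of_int (moebius_mu e)) (d div e))"

end

theory Submission
  imports Defs
begin

text \<open>
  Put \<open>S d = d M\<^sub>d\<close>.  For a prime \<open>p\<close> one has \<open>S (d p)(x) = S d (x\<^sup>p)\<close> if \<open>p\<close> divides \<open>d\<close>, and
  \<open>S (d p)(x) = S d (x\<^sup>p) - S d (x)\<close> otherwise.  Hence a polynomial \<open>g\<close> that divides \<open>g(x\<^sup>p)\<close> and
  \<open>M\<^sub>d\<close> also divides \<open>M\<^bsub>d p\<^esub>\<close>.  This applies to \<open>x\<^sup>m - 1\<close> for every \<open>p\<close>, and to \<open>x\<^sup>m + 1\<close> for odd \<open>p\<close>.
\<close>

definition necklace_sum :: "nat \<Rightarrow> rat poly" where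
  "necklace_sum d = (\<Sum>e | e dvd d. monom (of_int (moebius_mu e)) (d div e))"

lemma dvd_necklace_poly_iff:
  assumes "d \<ge> 1"
  shows "g dvd necklace_poly d \<longleftrightarrow> g dvd necklace_sum d"
  using assms by (simp add: necklace_poly_def necklace_sum_def dvd_smult_iff)

lemma moebius_mu_prime_mult:
  assumes "prime p" and "\<not> p dvd e"
  shows "moebius_mu (p * e) = - moebius_mu e"
proof (cases "e = 0")
  case False
  have cop: "coprime p e"
    using assms by (simp add: prime_imp_coprime)
  have "prime_factors (p * e) = insert p (prime_factors e)"
    using assms False by (auto simp: prime_factors_product prime_prime_factors prime_gt_0_nat)
  moreover have "p \<notin> prime_factors e"
    using assms by auto
  moreover have "squarefree (p * e) \<longleftrightarrow> squarefree e"
    using assms cop by (auto simp: squarefree_mult_coprime squarefree_prime dest: squarefree_multD)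
  ultimately show ?thesis
    by (simp add: moebius_mu_def)
qed (use assms in auto)

text \<open>The prime \<open>p\<close> occurs at most once in \<open>e\<close>, and \<open>d\<close>
  already supplies that one factor; the cofactor is coprime to \<open>p\<close>, so it divides
  \<open>d\<close> as well.\<close>

lemma squarefree_dvd_mult_prime:
  fixes p d e :: nat
  assumes "prime p" and "p dvd d" and "squarefree e" and "e dvd d * p"
  shows "e dvd d"
proof (cases "p dvd e")
  case True
  then obtain f where f: "e = p * f" by blast
  have "\<not> p dvd f"
    using assms(1,3) f by (auto simp: squarefree_def power2_eq_square elim!: allE[of _ p])
  then have "coprime p f"
    using assms(1) by (simp add: prime_imp_coprime)
  moreover have "f dvd d"
    using assms(1,4) f by (simp add: mult.commute)
  ultimately show ?thesis
    using assms(2) f by (simp add: divides_mult)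
next
  case False
  then have "coprime e p"
    using assms(1) prime_imp_coprime coprime_commute by blast
  then show ?thesis
    using assms(4) by (simp add: coprime_dvd_mult_left_iff)
qed

lemma pcompose_monom_monom:
  "pcompose (monom c n) (monom 1 p) = monom (c :: 'a :: comm_semiring_1) (n * p)"
proof (induction n)
  case 0
  show ?case by (simp add: monom_0)
qed (simp add: monom_Suc pcompose_pCons mult_monom)

text \<open>For \<open>e dvd d\<close> the new exponent \<open>(d div e) * p\<close> equals
  \<open>d * p div e\<close>. The result thus has the summands of
  \<open>necklace_sum (d * p)\<close>, restricted to the divisors of \<open>d\<close>.\<close>

lemma pcompose_necklace_sum:
  "pcompose (necklace_sum d) (monom 1 p) =
     (\<Sum>e | e dvd d. monom (of_int (moebius_mu e)) (d * p div e))"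
  unfolding necklace_sum_def pcompose_sum
  by (intro sum.cong) (auto simp: pcompose_monom_monom div_mult_swap mult.commute)

text \<open>A divisor of \<open>d * p\<close> that does not divide \<open>d\<close> is not
  squarefree, so its Moebius value is 0 and its term vanishes.\<close>

lemma necklace_sum_mult_prime_dvd:
  assumes "prime p" and "p dvd d" and "d \<ge> 1"
  shows "necklace_sum (d * p) = pcompose (necklace_sum d) (monom 1 p)"
proof -
  have "d * p > 0"
    using assms by (simp add: prime_gt_0_nat)
  then have "finite {e. e dvd d * p}"
    by simp
  then show ?thesis
    unfolding pcompose_necklace_sum unfolding necklace_sum_def
    by (intro sum.mono_neutral_right)
      (auto simp: moebius_mu_def dest: squarefree_dvd_mult_prime[OF assms(1,2)])
qed

text \<open>The divisors of \<open>d * p\<close> are the \<open>e\<close> and the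
  \<open>p * e\<close> with \<open>e dvd d\<close>. The first family gives the substituted sum, the
  second gives the subtracted one.\<close>

lemma necklace_sum_mult_prime_not_dvd:
  assumes "prime p" and "\<not> p dvd d"
  shows "necklace_sum (d * p) = pcompose (necklace_sum d) (monom 1 p) - necklace_sum d"
proof -
  let ?f = "\<lambda>e. monom (of_int (moebius_mu e) :: rat) (d * p div e)"
  have p: "p > 0" and d: "d > 0"
    using assms by (auto simp: prime_gt_0_nat intro: gr0I)
  have ndvd: "\<not> p dvd e" if "e dvd d" for e
    using that assms(2) dvd_trans by blast
  have split: "{e. e dvd d * p} = {e. e dvd d} \<union> (*) p ` {e. e dvd d}"
  proof (intro equalityI subsetI)
    fix e assume "e \<in> {e. e dvd d * p}"
    then have e: "e dvd d * p" by simp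
    show "e \<in> {e. e dvd d} \<union> (*) p ` {e. e dvd d}"
    proof (cases "p dvd e")
      case True
      then show ?thesis
        using e p by (auto simp: mult.commute elim!: dvdE[of p e])
    next
      case False
      then have "coprime e p"
        using assms(1) prime_imp_coprime coprime_commute by blast
      then show ?thesis
        using e by (simp add: coprime_dvd_mult_left_iff)
    qed
  qed (auto simp: mult.commute)
  have "necklace_sum (d * p) = sum ?f {e. e dvd d} + sum ?f ((*) p ` {e. e dvd d})"
    unfolding necklace_sum_def split
    by (rule sum.union_disjoint) (use d ndvd in auto)
  also have "sum ?f ((*) p ` {e. e dvd d}) = (\<Sum>e | e dvd d. ?f (p * e))"
    using p by (subst sum.reindex) (auto simp: inj_on_def)
  \<comment> \<open>The extra prime flips the sign of the Moebius value and cancels in the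
    exponent.\<close>
  also have "\<dots> = (\<Sum>e | e dvd d. - monom (of_int (moebius_mu e)) (d div e))"
    using p by (intro sum.cong)
      (auto simp: moebius_mu_prime_mult[OF assms(1) ndvd] minus_monom mult.commute[of d p])
  finally show ?thesis
    unfolding pcompose_necklace_sum by (simp add: sum_negf necklace_sum_def)
qed

lemma dvd_pcompose:
  fixes f g h :: "'a :: comm_ring_1 poly"
  assumes "f dvd g"
  shows "pcompose f h dvd pcompose g h"
  using assms by (auto elim!: dvdE simp: pcompose_mult)

lemma dvd_necklace_sum_mult_prime:
  assumes "prime p" and "d \<ge> 1"
    and "g dvd pcompose g (monom 1 p)" and "g dvd necklace_sum d"
  shows "g dvd necklace_sum (d * p)"
proof -
  \<comment> \<open>Substituting \<open>x\<^sup>p\<close> preserves divisibility, so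
    \<open>g\<close> divides \<open>g(x\<^sup>p)\<close>, which divides the substituted sum.\<close>
  have "g dvd pcompose (necklace_sum d) (monom 1 p)"
    using assms(3) dvd_pcompose[OF assms(4)] by (rule dvd_trans)
  then show ?thesis
    using assms
    by (cases "p dvd d")
      (simp_all add: necklace_sum_mult_prime_dvd necklace_sum_mult_prime_not_dvd)
qed

text \<open>Induction peels primes off \<open>e\<close> and moves each into \<open>d\<close>, hence
  the generalisation over \<open>d\<close>. Asking for the substitution property only at primes
  dividing \<open>e\<close> lets an odd \<open>e\<close> avoid \<open>p = 2\<close>.\<close>

lemma dvd_necklace_poly_mult:
  assumes "d \<ge> 1" and "e \<ge> 1" and "g dvd necklace_poly d"
    and "\<And>p. prime p \<Longrightarrow> p dvd e \<Longrightarrow> g dvd pcompose g (monom 1 p)"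
  shows "g dvd necklace_poly (d * e)"
  using assms
proof (induction e arbitrary: d rule: prime_divisors_induct)
  case (factor p e)
  have pos: "p \<ge> 1" "e \<ge> 1" "d * p \<ge> 1"
    using factor.prems(1,2) by (auto simp: Suc_le_eq)
  have "g dvd necklace_poly (d * p)"
    using factor pos by (auto simp: dvd_necklace_poly_iff intro: dvd_necklace_sum_mult_prime)
  then have "g dvd necklace_poly (d * p * e)"
    using pos by (intro factor.IH factor.prems(4)) auto
  then show ?case
    by (simp add: mult.assoc)
qed auto

lemma minus_dvd_power_minus:
  fixes x y :: "'a :: comm_ring_1"
  shows "x - y dvd x ^ n - y ^ n"
  by (simp add: power_diff_sumr2)

lemma monom_minus_one_dvd_pcompose:
  "(monom 1 m - 1 :: rat poly) dvd pcompose (monom 1 m - 1) (monom 1 p)"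
  using minus_dvd_power_minus[of "monom 1 m :: rat poly" 1 p]
  by (simp add: pcompose_diff pcompose_monom_monom monom_power pcompose_1)

text \<open>For odd \<open>p\<close>, \<open>(-1)\<^sup>p = -1\<close>, so \<open>y - (-1)\<close>
  divides \<open>y\<^sup>p + 1\<close>; here \<open>y = x\<^sup>m\<close>.\<close>

lemma monom_plus_one_dvd_pcompose:
  assumes "odd p"
  shows "(monom 1 m + 1 :: rat poly) dvd pcompose (monom 1 m + 1) (monom 1 p)"
  using minus_dvd_power_minus[of "monom 1 m :: rat poly" "-1" p] assms
  by (simp add: pcompose_add pcompose_monom_monom monom_power pcompose_1)

theorem theorem2p7:
  fixes m d :: nat
  assumes "m \<ge> 1" and "d \<ge> 1"
  shows "((monom 1 m - 1 :: rat poly) dvd necklace_poly d \<longrightarrow>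
            (\<forall>e::nat. e \<ge> 1 \<longrightarrow> (monom 1 m - 1 :: rat poly) dvd necklace_poly (d * e)))
       \<and> ((monom 1 m + 1 :: rat poly) dvd necklace_poly d \<longrightarrow>
            (\<forall>e::nat. e \<ge> 1 \<and> odd e \<longrightarrow> (monom 1 m + 1 :: rat poly) dvd necklace_poly (d * e)))"
proof (intro conjI impI allI)
  fix e :: nat
  assume "monom 1 m - 1 dvd necklace_poly d" and "e \<ge> 1"
  then show "monom 1 m - 1 dvd necklace_poly (d * e)"
    using assms(2) by (intro dvd_necklace_poly_mult monom_minus_one_dvd_pcompose)
next
  fix e :: nat
  assume "monom 1 m + 1 dvd necklace_poly d" and e: "e \<ge> 1 \<and> odd e"
  then show "monom 1 m + 1 dvd necklace_poly (d * e)"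
    using assms(2)
    \<comment> \<open>A prime divisor of the odd number \<open>e\<close> is odd, since otherwise 2
      would divide \<open>e\<close>.\<close>
    by (intro dvd_necklace_poly_mult monom_plus_one_dvd_pcompose) (auto dest: dvd_trans)
qed

end
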